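(* Assume that: $g$ is bounded; $f$ is convex and differentiable with $\nabla f$ Lipschitz continuous with constant $L$; for every $\lambda\in\mathrm{dom}(f^* )$, $g_\lambda$ is lower semi-continuous on $Z$, $G_\lambda$ is a lower semi-continuous set-valued map and $\mathrm{BR}_\lambda(x)\ne\emptyset$ for all $x\in X$. Assume moreover that: $X$ is a closed subset of a separable Banach space; $g\colon Z\to\mathcal{H}$ is continuous; $Z_x$ is compact for every $x\in X$ and $F$ is upper semi-continuous; and there is $L_g\ge0$ such that $\mathcal{Z}\colon X\rightsquigarrow\mathcal{H}$, $\mathcal{Z}(x)=\{g(x,y):y\in Z_x\}$, is $L_g$-Lipschitz. Let $C^*$ be a constant such that $\|\lambda^*(m)\|\le C^*$ for all $m\in\mathcal{P}(X)$. Then for any $m_0,m_1\in\mathcal{P}^1(X)$, $$\left|\mathcal{D}_{m_0}(\lambda^*(m_0))-\mathcal{D}_{m_1}(\lambda^*(m_1))\right|\le C^*L_g\,d_1(m_0,m_1),$$ $$\|\lambda^*(m_0)-\lambda^*(m_1)\|^2\le 2C^*L_gL\,d_1(m_0,m_1).$$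
   Context: $X$ and $Y$ are complete separable metric spaces with metrics $d_X,d_Y$ and Borel $\sigma$-algebras; $\mathcal{P}(\cdot)$ denotes the set of Borel probability measures. $F\colon X\rightsquigarrow Y$ is a set-valued map with non-empty values and closed graph; $Z_x:=F(x)$, $Z:=\{(x,y): y\in Z_x\}\subseteq X\times Y$. $\mathcal{H}$ is a separable real Hilbert space; $g\colon Z\to\mathcal{H}$, $f\colon\mathcal{H}\to\mathbb{R}$ are Borel measurable. For $\lambda\in\mathcal{H}$: $g_\lambda(x,y)=\langle\lambda,g(x,y)\rangle$, $u_\lambda(x)=\inf_{y\in Z_x}g_\lambda(x,y)$, $G_\lambda(x)=\{g_\lambda(x,y):y\in Z_x\}\subseteq\mathbb{R}$, $\mathrm{BR}_\lambda(x)=\operatorname{argmin}_{y\in Z_x}g_\lambda(x,y)$. $f^*(\lambda)=\sup_{\beta\in\mathcal{H}}(\langle\lambda,\beta\rangle-f(\beta))$ and $\mathrm{dom}(f^* )=\{f^*<+\infty\}$. For $m\in\mathcal{P}(X)$, $\mathcal{D}_m(\lambda)=f^*(\lambda)-\int_X u_\lambda\,dm$ for $\lambda\in\mathrm{dom}(f^* )$, and $\lambda^*(m)$ denotes the minimizer of $\mathcal{D}_m$ over $\mathrm{dom}(f^* )$; under the assumptions it exists, is unique, and is bounded in norm by a constant $C^*$ independent of $m$. $\mathcal{P}^1(X)$ is the set of $m\in\mathcal{P}(X)$ with $\int d_X(x,x_0)\,dm(x)<\infty$ for some $x_0\in X$; $d_1(m_0,m_1)=\sup\{\int_X h\,d(m_0-m_1):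 h\colon X\to\mathbb{R}\text{ 1-Lipschitz}\}$. Set-valued maps $\Phi$ (non-empty values): lower semi-continuous if for every $x$, $y\in\Phi(x)$ and $x_n\to x$ there are $y_n\in\Phi(x_n)$ with $y_n\to y$; upper semi-continuous if for every $x$ and every neighborhood $\mathcal{U}$ of $\Phi(x)$ there is $\eta>0$ with $\Phi(x')\subseteq\mathcal{U}$ whenever $d_X(x,x')\le\eta$; $\mathcal{Z}$ is $L_g$-Lipschitz if $\mathcal{Z}(x_1)\subseteq\mathcal{Z}(x_2)+B_{\mathcal{H}}(0,L_g d_X(x_1,x_2))$ for all $x_1,x_2\in X$ (closed ball). *)

theory Defs
  imports "HOL-Probability.Probability"
begin

text \<open>The space \<open>X\<close> is a closed subset (a carrier set) of a separable Banach space, with the metric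
  induced by the norm. Maps out of \<open>X\<close> are total functions of which only the values on \<open>X\<close> matter.\<close>

section \<open>Set-valued maps\<close>

definition graph_on :: "'x set \<Rightarrow> ('x \<Rightarrow> 'y set) \<Rightarrow> ('x \<times> 'y) set" where
  "graph_on X F = {(x, y). x \<in> X \<and> y \<in> F x}"

definition lsc_setmap :: "'x::metric_space set \<Rightarrow> ('x \<Rightarrow> 'y::metric_space set) \<Rightarrow> bool" where
  "lsc_setmap X \<Phi> \<longleftrightarrow>
    (\<forall>x\<in>X. \<forall>y\<in>\<Phi> x. \<forall>s. (\<forall>n::nat. s n \<in> X) \<and> s \<longlonglongrightarrow> x \<longrightarrow>
      (\<exists>t. (\<forall>n. t n \<in> \<Phi> (s n)) \<and> t \<longlonglongrightarrow> y))"

text \<open>A neighborhood of a set is a set whose interior contains it.\<close>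

definition usc_setmap :: "'x::metric_space set \<Rightarrow> ('x \<Rightarrow> 'y::metric_space set) \<Rightarrow> bool" where
  "usc_setmap X \<Phi> \<longleftrightarrow>
    (\<forall>x\<in>X. \<forall>U. \<Phi> x \<subseteq> interior U \<longrightarrow> (\<exists>\<eta>>0. \<forall>x'\<in>X. dist x x' \<le> \<eta> \<longrightarrow> \<Phi> x' \<subseteq> U))"

definition lipschitz_setmap ::
    "real \<Rightarrow> 'x::metric_space set \<Rightarrow> ('x \<Rightarrow> 'h::real_normed_vector set) \<Rightarrow> bool" where
  "lipschitz_setmap K X \<Phi> \<longleftrightarrow>
    (\<forall>x\<^sub>1\<in>X. \<forall>x\<^sub>2\<in>X. \<Phi> x\<^sub>1 \<subseteq> {a + b | a b. a \<in> \<Phi> x\<^sub>2 \<and> b \<in> cball 0 (K * dist x\<^sub>1 x\<^sub>2)})"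

definition lsc_on :: "'z::topological_space set \<Rightarrow> ('z \<Rightarrow> real) \<Rightarrow> bool" where
  "lsc_on Z \<phi> \<longleftrightarrow> (\<forall>z\<in>Z. \<forall>c<\<phi> z. eventually (\<lambda>w. c < \<phi> w) (at z within Z))"

section \<open>The value function and the dual problem\<close>

definition u_fun :: "('x \<Rightarrow> 'y set) \<Rightarrow> ('x \<times> 'y \<Rightarrow> 'h::real_inner) \<Rightarrow> 'h \<Rightarrow> 'x \<Rightarrow> real" where
  "u_fun F g l x = (INF y\<in>F x. l \<bullet> g (x, y))"

definition G_map :: "('x \<Rightarrow> 'y set) \<Rightarrow> ('x \<times> 'y \<Rightarrow> 'h::real_inner) \<Rightarrow> 'h \<Rightarrow> 'x \<Rightarrow> real set" where
  "G_map F g l x = {l \<bullet> g (x, y) | y. y \<in> F x}"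

definition BR :: "('x \<Rightarrow> 'y set) \<Rightarrow> ('x \<times> 'y \<Rightarrow> 'h::real_inner) \<Rightarrow> 'h \<Rightarrow> 'x \<Rightarrow> 'y set" where
  "BR F g l x = {y. is_arg_min (\<lambda>y. l \<bullet> g (x, y)) (\<lambda>y. y \<in> F x) y}"

definition fstar :: "('h::real_inner \<Rightarrow> real) \<Rightarrow> 'h \<Rightarrow> ereal" where
  "fstar f l = (SUP \<beta>. ereal (l \<bullet> \<beta> - f \<beta>))"

definition dom_fstar :: "('h::real_inner \<Rightarrow> real) \<Rightarrow> 'h set" where
  "dom_fstar f = {l. fstar f l < \<infinity>}"

text \<open>Since \<open>f\<close> is real-valued, \<open>fstar f\<close> never takes the value \<open>-\<infinity>\<close>, so it is finite on its
  domain. The dual function is meaningful only there.\<close>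

definition dual_fun :: "('x \<Rightarrow> 'y set) \<Rightarrow> ('x \<times> 'y \<Rightarrow> 'h::real_inner) \<Rightarrow> ('h \<Rightarrow> real) \<Rightarrow>
    'x measure \<Rightarrow> 'h \<Rightarrow> real" where
  "dual_fun F g f m l = real_of_ereal (fstar f l) - (LINT x|m. u_fun F g l x)"

definition lambda_star :: "('x \<Rightarrow> 'y set) \<Rightarrow> ('x \<times> 'y \<Rightarrow> 'h::real_inner) \<Rightarrow> ('h \<Rightarrow> real) \<Rightarrow>
    'x measure \<Rightarrow> 'h" where
  "lambda_star F g f m = arg_min_on (dual_fun F g f m) (dom_fstar f)"

section \<open>Probability measures\<close>

definition prob_measures :: "'x::topological_space set \<Rightarrow> 'x measure set" where
  "prob_measures X = {m. prob_space m \<and> sets m = sets (restrict_space borel X)}"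

definition prob_measures1 :: "'x::metric_space set \<Rightarrow> 'x measure set" where
  "prob_measures1 X = {m \<in> prob_measures X. \<exists>x\<^sub>0\<in>X. integrable m (\<lambda>x. dist x x\<^sub>0)}"

text \<open>The supremum is over a nonempty set, bounded above when \<open>m\<^sub>0\<close> and \<open>m\<^sub>1\<close> lie in
  \<open>prob_measures1 X\<close>.\<close>

definition d1 :: "'x::metric_space set \<Rightarrow> 'x measure \<Rightarrow> 'x measure \<Rightarrow> real" where
  "d1 X m\<^sub>0 m\<^sub>1 = Sup {(LINT x|m\<^sub>0. h x) - (LINT x|m\<^sub>1. h x) | h::'x \<Rightarrow> real. 1-lipschitz_on X h}"

end

theory Submission
  imports Defs
begin

text \<open>
  An \<open>L\<close>-Lipschitz gradient of \<open>f\<close> makes the conjugate \<open>f\<^sup>*\<close> strongly convex with modulus \<open>1/L\<close>.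
  The integrals of \<open>u\<^sub>\<lambda>\<close> are concave and Lipschitz in \<open>\<lambda>\<close>, so the dual function
  inherits this strong convexity; minimizing sequences are therefore Cauchy, and the dual function
  grows quadratically away from its minimizer.
  On the other hand \<open>u\<^sub>\<lambda>\<close> is Lipschitz on \<open>X\<close> with constant \<open>\<parallel>\<lambda>\<parallel> L\<^sub>g\<close>, so the dual functions of
  \<open>m\<^sub>0\<close> and \<open>m\<^sub>1\<close> differ at \<open>\<lambda>\<close> by at most \<open>\<parallel>\<lambda>\<parallel> L\<^sub>g d\<^sub>1(m\<^sub>0, m\<^sub>1)\<close>. Evaluating
  each dual function at the other one's minimizer gives both estimates.
\<close>

section \<open>Strongly convex functions\<close>

text \<open>The coefficient \<open>c\<close> carries no factor one half, so the usual modulus of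
  strong convexity is \<open>2 * c\<close>; modulus \<open>1 / L\<close> therefore appears below as
  \<open>1 / (2 * L)\<close>.\<close>

definition strongly_convex_on :: "real \<Rightarrow> 'a::real_normed_vector set \<Rightarrow> ('a \<Rightarrow> real) \<Rightarrow> bool" where
  "strongly_convex_on c S \<Phi> \<longleftrightarrow> convex S \<and>
    (\<forall>a\<in>S. \<forall>b\<in>S. \<forall>t. 0 < t \<and> t < 1 \<longrightarrow>
      \<Phi> ((1 - t) *\<^sub>R a + t *\<^sub>R b) \<le> (1 - t) * \<Phi> a + t * \<Phi> b - c * t * (1 - t) * (norm (a - b))\<^sup>2)"

text \<open>Compare the minimum with the value at a point of the segment from \<open>a\<close> to
  \<open>b\<close>, cancel the common factor \<open>t\<close>, and let \<open>t\<close> tend to 0 to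
  remove the remaining factor \<open>1 - t\<close>.\<close>

lemma strongly_convex_on_growth:
  assumes sc: "strongly_convex_on c S \<Phi>" and a: "a \<in> S" and b: "b \<in> S"
    and min: "\<And>x. x \<in> S \<Longrightarrow> \<Phi> a \<le> \<Phi> x"
  shows "\<Phi> a + c * (norm (a - b))\<^sup>2 \<le> \<Phi> b"
proof -
  have ineq: "\<Phi> a + c * (1 - t) * (norm (a - b))\<^sup>2 \<le> \<Phi> b" if "0 < t" "t < 1" for t
  proof -
    let ?x = "(1 - t) *\<^sub>R a + t *\<^sub>R b"
    have "?x \<in> S"
      using sc a b that unfolding strongly_convex_on_def convex_alt by simp
    then have "\<Phi> a \<le> (1 - t) * \<Phi> a + t * \<Phi> b - c * t * (1 - t) * (norm (a - b))\<^sup>2"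
      using min[of ?x] sc a b that unfolding strongly_convex_on_def by fastforce
    then have "t * (\<Phi> a + c * (1 - t) * (norm (a - b))\<^sup>2) \<le> t * \<Phi> b"
      by (simp add: algebra_simps)
    then show ?thesis using that by simp
  qed
  have "((\<lambda>t. \<Phi> a + c * (1 - t) * (norm (a - b))\<^sup>2) \<longlongrightarrow> \<Phi> a + c * (1 - 0) * (norm (a - b))\<^sup>2)
      (at_right 0)"
    by (intro tendsto_intros)
  moreover have "\<forall>\<^sub>F t in at_right 0. \<Phi> a + c * (1 - t) * (norm (a - b))\<^sup>2 \<le> \<Phi> b"
    unfolding eventually_at_right_field by (rule exI[of _ 1]) (use ineq in auto)
  ultimately show ?thesis
    using tendsto_upperbound[of _ _ "at_right (0::real)"] by fastforce
qed

text \<open>\<open>S\<close> need not be closed. Hypothesis \<open>lsc\<close> is closedness of the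
  epigraph, tested on sequences whose values converge, so it also places the limit of a minimizing
  sequence in \<open>S\<close>.\<close>

lemma strongly_convex_on_minimizer_exists:
  fixes \<Phi> :: "'a::banach \<Rightarrow> real"
  assumes sc: "strongly_convex_on c S \<Phi>" and c: "c > 0" and ne: "S \<noteq> {}"
    and below: "bdd_below (\<Phi> ` S)"
    and lsc: "\<And>s l I. (\<And>n::nat. s n \<in> S) \<Longrightarrow> s \<longlonglongrightarrow> l \<Longrightarrow> (\<lambda>n. \<Phi> (s n)) \<longlonglongrightarrow> I \<Longrightarrow> l \<in> S \<and> \<Phi> l \<le> I"
  shows "\<exists>l\<in>S. \<forall>x\<in>S. \<Phi> l \<le> \<Phi> x"
proof -
  define I where "I = (INF x\<in>S. \<Phi> x)"
  have I_le: "I \<le> \<Phi> x" if "x \<in> S" for x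
    unfolding I_def using below that by (rule cINF_lower)
  have "\<exists>x\<in>S. \<Phi> x < I + 1 / real (Suc n)" for n
    using cINF_less_iff[OF ne below, of "I + 1 / real (Suc n)"] unfolding I_def by simp
  then obtain s where s: "\<And>n. s n \<in> S" "\<And>n. \<Phi> (s n) < I + 1 / real (Suc n)"
    by metis
  have lim: "(\<lambda>n. \<Phi> (s n)) \<longlonglongrightarrow> I"
  proof (rule tendsto_sandwich)
    show "\<forall>\<^sub>F n in sequentially. I \<le> \<Phi> (s n)"
      using s(1) I_le by simp
    show "\<forall>\<^sub>F n in sequentially. \<Phi> (s n) \<le> I + 1 / real (Suc n)"
      using s(2) by (intro always_eventually allI less_imp_le)
    show "(\<lambda>n. I + 1 / real (Suc n)) \<longlonglongrightarrow> I"
      using tendsto_add[OF tendsto_const[of I] LIMSEQ_inverse_real_of_nat]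
      by (simp add: inverse_eq_divide)
  qed simp
  have half: "0 < (1/2 :: real)" "(1/2 :: real) < 1" by simp_all
  have dist2: "c / 4 * (norm (s m - s n))\<^sup>2 < 1 / real (Suc m) + 1 / real (Suc n)" for m n
  proof -
    \<comment> \<open>At the midpoint the value is still at least \<open>I\<close>, while the two
      endpoint values exceed \<open>I\<close> only slightly; the quadratic gain is squeezed in
      between. The factor one half on the errors is discarded.\<close>
    let ?x = "(1 - 1/2) *\<^sub>R s m + (1/2) *\<^sub>R s n"
    have "?x \<in> S"
      using sc s(1) half[THEN less_imp_le] unfolding strongly_convex_on_def convex_alt by blast
    then have "I \<le> \<Phi> ?x" by (rule I_le)
    also have "\<dots> \<le> (1 - 1/2) * \<Phi> (s m) + 1/2 * \<Phi> (s n) - c * (1/2) * (1 - 1/2) * (norm (s m - s n))\<^sup>2"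
      using sc s(1)[of m] s(1)[of n] half unfolding strongly_convex_on_def by blast
    finally have "I \<le> \<Phi> (s m) / 2 + \<Phi> (s n) / 2 - c / 4 * (norm (s m - s n))\<^sup>2" by simp
    moreover have "1 / real (Suc m) > 0" "1 / real (Suc n) > 0" by simp_all
    ultimately show ?thesis using s(2)[of m] s(2)[of n] by linarith
  qed
  have "Cauchy s"
  proof (rule metric_CauchyI)
    fix e :: real assume e: "e > 0"
    \<comment> \<open>Two errors, each below this number, add up to less than
      \<open>c / 4 * e\<^sup>2\<close>.\<close>
    then have "c * e\<^sup>2 / 8 > 0" using c by simp
    then obtain N where N: "1 / real (Suc N) < c * e\<^sup>2 / 8"
      using nat_approx_posE by blast
    have "dist (s m) (s n) < e" if "m \<ge> N" "n \<ge> N" for m n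
    proof -
      have "1 / real (Suc m) \<le> 1 / real (Suc N)" "1 / real (Suc n) \<le> 1 / real (Suc N)"
        using that by (auto intro!: divide_left_mono)
      then have "c / 4 * (norm (s m - s n))\<^sup>2 < c / 4 * e\<^sup>2"
        using dist2[of m n] N by linarith
      then have "(norm (s m - s n))\<^sup>2 < e\<^sup>2" using c by simp
      then show ?thesis using e by (simp add: dist_norm power2_less_imp_less)
    qed
    then show "\<exists>N. \<forall>m\<ge>N. \<forall>n\<ge>N. dist (s m) (s n) < e" by blast
  qed
  then obtain l where "s \<longlonglongrightarrow> l" using Cauchy_convergent convergent_def by blast
  then have "l \<in> S" "\<Phi> l \<le> I" using lsc s(1) lim by blast+
  then show ?thesis using I_le by force
qed

section \<open>Functions with Lipschitz gradient and their conjugates\<close>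

lemma GDERIV_along_line:
  assumes "GDERIV f (a + t *\<^sub>R d) :> D"
  shows "((\<lambda>t. f (a + t *\<^sub>R d)) has_real_derivative (D \<bullet> d)) (at t)"
proof -
  have "((\<lambda>t. a + t *\<^sub>R d) has_derivative (\<lambda>h. h *\<^sub>R d)) (at t)"
    by (auto intro!: derivative_eq_intros)
  from has_derivative_compose[OF this assms[unfolded gderiv_def]]
  show ?thesis
    by (rule has_derivative_imp_has_field_derivative) (simp add: inner_commute)
qed

text \<open>The descent lemma. Along the segment, \<open>\<phi>\<close> is \<open>f\<close> minus
  its quadratic model up to a constant; Cauchy-Schwarz and the Lipschitz gradient make its
  derivative nonpositive.\<close>

lemma lipschitz_gradient_upper_bound:
  assumes grad: "\<And>x. GDERIV f x :> f' x" and lip: "L-lipschitz_on UNIV f'"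
  shows "f (a + d) \<le> f a + f' a \<bullet> d + L / 2 * (norm d)\<^sup>2"
proof -
  define \<phi> where "\<phi> = (\<lambda>t. f (a + t *\<^sub>R d) - t * (f' a \<bullet> d) - L / 2 * t\<^sup>2 * (norm d)\<^sup>2)"
  have "\<phi> 1 \<le> \<phi> 0"
  proof (rule DERIV_nonpos_imp_nonincreasing[where f = \<phi>])
    fix t :: real assume t: "0 \<le> t" "t \<le> 1"
    have "(\<phi> has_real_derivative
        f' (a + t *\<^sub>R d) \<bullet> d - f' a \<bullet> d - L * t * (norm d)\<^sup>2) (at t)"
      unfolding \<phi>_def
      by (rule derivative_eq_intros GDERIV_along_line[OF grad] refl | simp)+
    moreover have "(f' (a + t *\<^sub>R d) - f' a) \<bullet> d \<le> L * t * (norm d)\<^sup>2"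
    proof -
      have "(f' (a + t *\<^sub>R d) - f' a) \<bullet> d \<le> norm (f' (a + t *\<^sub>R d) - f' a) * norm d"
        by (rule norm_cauchy_schwarz)
      also have "\<dots> \<le> (L * norm (t *\<^sub>R d)) * norm d"
        using lipschitz_onD[OF lip, of "a + t *\<^sub>R d" a]
        by (intro mult_right_mono) (auto simp: dist_norm)
      finally show ?thesis using t by (simp add: power2_eq_square mult_ac)
    qed
    ultimately show "\<exists>y. (\<phi> has_real_derivative y) (at t) \<and> y \<le> 0"
      by (intro exI conjI) (auto simp: inner_diff_left)
  qed simp
  then show ?thesis by (simp add: \<phi>_def)
qed

text \<open>Restricting \<open>f\<close> to the line through \<open>a\<close> and \<open>b\<close>
  reduces this to the tangent inequality for convex functions of one real variable.\<close>

lemma convex_on_gradient_lower_bound: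
  assumes conv: "convex_on UNIV f" and grad: "GDERIV f a :> D"
  shows "f a + D \<bullet> (b - a) \<le> f b"
proof -
  define \<phi> where "\<phi> = (\<lambda>t. f (a + t *\<^sub>R (b - a)))"
  have "convex_on UNIV \<phi>"
  proof (rule convex_onI)
    fix t x y :: real assume t: "0 < t" "t < 1"
    have "a + ((1 - t) *\<^sub>R x + t *\<^sub>R y) *\<^sub>R (b - a) =
        (1 - t) *\<^sub>R (a + x *\<^sub>R (b - a)) + t *\<^sub>R (a + y *\<^sub>R (b - a))"
      by (simp add: algebra_simps)
    then show "\<phi> ((1 - t) *\<^sub>R x + t *\<^sub>R y) \<le> (1 - t) * \<phi> x + t * \<phi> y"
      unfolding \<phi>_def using convex_onD[OF conv, of t] t by simp
  qed simp
  moreover have "(\<phi> has_real_derivative D \<bullet> (b - a)) (at 0)"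
    unfolding \<phi>_def by (rule GDERIV_along_line) (use grad in simp)
  ultimately have "\<phi> 1 - \<phi> 0 \<ge> (D \<bullet> (b - a)) * (1 - 0)"
    by (intro convex_on_imp_above_tangent[of UNIV]) auto
  then show ?thesis by (simp add: \<phi>_def)
qed

section \<open>The conjugate on its effective domain\<close>

lemma fstar_upper:
  assumes "l \<in> dom_fstar f"
  shows "l \<bullet> \<beta> - f \<beta> \<le> real_of_ereal (fstar f l)"
proof -
  have le: "ereal (l \<bullet> \<beta> - f \<beta>) \<le> fstar f l"
    unfolding fstar_def by (rule SUP_upper) simp
  with assms show ?thesis
    by (cases "fstar f l") (auto simp: dom_fstar_def)
qed

lemma fstar_least:
  assumes "\<And>\<beta>. l \<bullet> \<beta> - f \<beta> \<le> c"
  shows "l \<in> dom_fstar f" and "real_of_ereal (fstar f l) \<le> c"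
proof -
  have le: "fstar f l \<le> ereal c"
    unfolding fstar_def by (rule SUP_least) (use assms in simp)
  then show dom: "l \<in> dom_fstar f" by (auto simp: dom_fstar_def)
  show "real_of_ereal (fstar f l) \<le> c"
  proof (cases "fstar f l")
    \<comment> \<open>Here \<open>real_of_ereal\<close> would return the default value 0, which
      \<open>c\<close> need not dominate; the test point 0 rules the case out.\<close>
    case MInf
    have "ereal (l \<bullet> 0 - f 0) \<le> fstar f l"
      unfolding fstar_def by (rule SUP_upper) simp
    with MInf show ?thesis by simp
  qed (use le dom in \<open>auto simp: dom_fstar_def\<close>)
qed

text \<open>The tangent inequality at \<open>a\<close> bounds every term of the supremum. This shows
  that the domain of the dual problem is not empty.\<close>

lemma gradient_in_dom_fstar:
  assumes "convex_on UNIV f" and "GDERIV f a :> D"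
  shows "D \<in> dom_fstar f"
proof (rule fstar_least(1))
  show "D \<bullet> \<beta> - f \<beta> \<le> D \<bullet> a - f a" for \<beta>
    using convex_on_gradient_lower_bound[OF assms, of \<beta>] by (simp add: inner_diff_right)
qed

text \<open>This is the coercivity of the dual problem: quadratic growth of the conjugate will
  outweigh the linear growth of the integral term.\<close>

lemma fstar_quadratic_lower_bound:
  assumes grad: "\<And>x. GDERIV f x :> f' x" and lip: "L-lipschitz_on UNIV f'" and L: "L > 0"
    and l: "l \<in> dom_fstar f"
  shows "(norm (l - f' 0))\<^sup>2 / (2 * L) - f 0 \<le> real_of_ereal (fstar f l)"
proof -
  \<comment> \<open>The maximizer of \<open>l \<bullet> \<beta>\<close> minus the quadratic upper
    model of \<open>f\<close> at 0.\<close>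
  define \<beta> where "\<beta> = (1 / L) *\<^sub>R (l - f' 0)"
  have "f \<beta> \<le> f 0 + f' 0 \<bullet> \<beta> + L / 2 * (norm \<beta>)\<^sup>2"
    using lipschitz_gradient_upper_bound[OF grad lip, of 0 \<beta>] by simp
  moreover have "l \<bullet> \<beta> - f \<beta> \<le> real_of_ereal (fstar f l)"
    by (rule fstar_upper[OF l])
  moreover have "l \<bullet> \<beta> - f' 0 \<bullet> \<beta> = (norm (l - f' 0))\<^sup>2 / L"
    by (simp add: \<beta>_def power2_norm_eq_inner flip: inner_diff_left diff_divide_distrib)
  moreover have "L / 2 * (norm \<beta>)\<^sup>2 = (norm (l - f' 0))\<^sup>2 / (2 * L)"
    using L by (simp add: \<beta>_def power_divide power2_eq_square)
  moreover have "(norm (l - f' 0))\<^sup>2 / L = (norm (l - f' 0))\<^sup>2 / (2 * L) + (norm (l - f' 0))\<^sup>2 / (2 * L)"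
    by (simp add: field_simps)
  ultimately show ?thesis by linarith
qed

text \<open>The bound is proved for each \<open>\<beta>\<close> with a right-hand side free of
  \<open>\<beta>\<close>, so \<open>fstar_least\<close> yields both the inequality and the convexity
  of the domain. The latter is why \<open>key\<close> includes the endpoints of the range of
  \<open>t\<close>.\<close>

lemma strongly_convex_on_fstar:
  assumes grad: "\<And>x. GDERIV f x :> f' x" and lip: "L-lipschitz_on UNIV f'" and L: "L > 0"
  shows "strongly_convex_on (1 / (2 * L)) (dom_fstar f) (\<lambda>l. real_of_ereal (fstar f l))"
proof -
  let ?r = "\<lambda>l. real_of_ereal (fstar f l)"
  have key: "((1 - t) *\<^sub>R a + t *\<^sub>R b) \<bullet> \<beta> - f \<beta>
      \<le> (1 - t) * ?r a + t * ?r b - 1 / (2 * L) * t * (1 - t) * (norm (a - b))\<^sup>2"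
    if a: "a \<in> dom_fstar f" and b: "b \<in> dom_fstar f" and t: "0 \<le> t" "t \<le> 1" for a b t \<beta>
  proof -
    \<comment> \<open>The test points average to \<open>\<beta>\<close>, so the gradient terms at \<open>\<beta>\<close> cancel.\<close>
    define d where "d = a - b"
    define q where "q = (norm d)\<^sup>2"
    define p where "p = (t / L) *\<^sub>R d"
    define r where "r = - (((1 - t) / L) *\<^sub>R d)"
    have p: "a \<bullet> (\<beta> + p) - f (\<beta> + p) \<le> ?r a" and r: "b \<bullet> (\<beta> + r) - f (\<beta> + r) \<le> ?r b"
      using a b by (auto intro: fstar_upper)
    have fp: "f (\<beta> + p) \<le> f \<beta> + f' \<beta> \<bullet> p + L / 2 * (norm p)\<^sup>2"
      and fr: "f (\<beta> + r) \<le> f \<beta> + f' \<beta> \<bullet> r + L / 2 * (norm r)\<^sup>2"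
      by (rule lipschitz_gradient_upper_bound[OF grad lip])+
    have np: "L / 2 * (norm p)\<^sup>2 = t\<^sup>2 * q / (2 * L)"
      and nr: "L / 2 * (norm r)\<^sup>2 = (1 - t)\<^sup>2 * q / (2 * L)"
      using L by (auto simp: p_def r_def q_def power_divide power_mult_distrib power2_eq_square)
    have "(1 - t) * (a \<bullet> (\<beta> + p) - (f \<beta> + f' \<beta> \<bullet> p + t\<^sup>2 * q / (2 * L)))
        + t * (b \<bullet> (\<beta> + r) - (f \<beta> + f' \<beta> \<bullet> r + (1 - t)\<^sup>2 * q / (2 * L)))
        \<le> (1 - t) * ?r a + t * ?r b"
      using p r fp fr np nr t by (intro add_mono mult_left_mono) auto
    \<comment> \<open>The shifts gain \<open>t * (1 - t) * q / L\<close> in the inner products. The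
      quadratic errors cost half of it, since
      \<open>(1 - t) * t\<^sup>2 + t * (1 - t)\<^sup>2 = t * (1 - t)\<close>.\<close>
    moreover have "(1 - t) * (a \<bullet> (\<beta> + p) - (f \<beta> + f' \<beta> \<bullet> p + t\<^sup>2 * q / (2 * L)))
        + t * (b \<bullet> (\<beta> + r) - (f \<beta> + f' \<beta> \<bullet> r + (1 - t)\<^sup>2 * q / (2 * L)))
        = ((1 - t) *\<^sub>R a + t *\<^sub>R b) \<bullet> \<beta> - f \<beta> + t * (1 - t) / L * (d \<bullet> d)
          - t * (1 - t) * q / (2 * L)"
      using L unfolding p_def r_def d_def
      by (simp add: field_simps inner_simps power2_eq_square)
    moreover have "t * (1 - t) / L * (d \<bullet> d) = t * (1 - t) * q / (2 * L) + t * (1 - t) * q / (2 * L)"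
      using L by (simp add: q_def power2_norm_eq_inner field_simps)
    moreover have "1 / (2 * L) * t * (1 - t) * (norm (a - b))\<^sup>2 = t * (1 - t) * q / (2 * L)"
      by (simp add: q_def d_def)
    ultimately show ?thesis by (simp only:)
  qed
  show ?thesis
    unfolding strongly_convex_on_def convex_alt
    using fstar_least[OF key] by auto
qed

section \<open>The dual function\<close>

text \<open>\<open>M\<close> will control the dependence of \<open>u_fun\<close> on the multiplier,
  and \<open>K\<close>, in the role of \<open>L\<^sub>g\<close>, its dependence on the point of
  \<open>X\<close>.\<close>

locale dual_problem =
  fixes X :: "'x::metric_space set" and F :: "'x \<Rightarrow> 'y set"
    and g :: "'x \<times> 'y \<Rightarrow> 'h::{real_inner, banach}" and K M :: real
  assumes F_ne: "x \<in> X \<Longrightarrow> F x \<noteq> {}"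
    and g_le: "x \<in> X \<Longrightarrow> y \<in> F x \<Longrightarrow> norm (g (x, y)) \<le> M"
    and K_nonneg: "K \<ge> 0"
    and g_lip: "lipschitz_setmap K X (\<lambda>x. {g (x, y) | y. y \<in> F x})"
begin

lemma inner_g_ge:
  assumes "x \<in> X" "y \<in> F x"
  shows "- (M * norm l) \<le> l \<bullet> g (x, y)"
proof -
  have "\<bar>l \<bullet> g (x, y)\<bar> \<le> norm l * norm (g (x, y))" by (rule Cauchy_Schwarz_ineq2)
  also have "\<dots> \<le> norm l * M" using g_le assms by (intro mult_left_mono) auto
  finally show ?thesis by (simp add: mult.commute)
qed

lemma u_fun_le: "x \<in> X \<Longrightarrow> y \<in> F x \<Longrightarrow> u_fun F g l x \<le> l \<bullet> g (x, y)"
  unfolding u_fun_def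
  by (rule cINF_lower) (auto intro!: bdd_belowI2[of _ "- (M * norm l)"] inner_g_ge)

lemma u_fun_greatest: "x \<in> X \<Longrightarrow> (\<And>y. y \<in> F x \<Longrightarrow> c \<le> l \<bullet> g (x, y)) \<Longrightarrow> c \<le> u_fun F g l x"
  unfolding u_fun_def by (rule cINF_greatest) (auto simp: F_ne)

lemma u_fun_concave:
  assumes "x \<in> X" "0 \<le> t" "t \<le> 1"
  shows "(1 - t) * u_fun F g a x + t * u_fun F g b x \<le> u_fun F g ((1 - t) *\<^sub>R a + t *\<^sub>R b) x"
proof (rule u_fun_greatest[OF assms(1)])
  fix y assume "y \<in> F x"
  then show "(1 - t) * u_fun F g a x + t * u_fun F g b x \<le> ((1 - t) *\<^sub>R a + t *\<^sub>R b) \<bullet> g (x, y)"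
    using assms by (auto simp: inner_add_left intro!: add_mono mult_left_mono u_fun_le)
qed

text \<open>Replacing \<open>a\<close> by \<open>b\<close> moves each inner product by at most
  \<open>M * norm (a - b)\<close>, uniformly in \<open>y\<close>, so the bound survives the
  infimum.\<close>

lemma u_fun_diff_le:
  assumes "x \<in> X"
  shows "u_fun F g a x \<le> u_fun F g b x + M * norm (a - b)"
proof -
  have "u_fun F g a x - M * norm (b - a) \<le> u_fun F g b x"
  proof (rule u_fun_greatest[OF assms])
    fix y assume "y \<in> F x"
    then show "u_fun F g a x - M * norm (b - a) \<le> b \<bullet> g (x, y)"
      using u_fun_le[OF assms, of y a] inner_g_ge[OF assms, of y "b - a"]
      by (simp add: inner_diff_left)
  qed
  then show ?thesis by (simp add: norm_minus_commute)
qed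

lemma u_fun_0: "x \<in> X \<Longrightarrow> u_fun F g 0 x = 0"
  using F_ne[of x] by (simp add: u_fun_def)

lemma abs_u_fun_le: "x \<in> X \<Longrightarrow> \<bar>u_fun F g l x\<bar> \<le> M * norm l"
  using u_fun_diff_le[of x l 0] u_fun_diff_le[of x 0 l] u_fun_0[of x]
  by (auto simp: abs_le_iff norm_minus_commute)

text \<open>The set inclusion matches each value \<open>g (x, y)\<close> with some
  \<open>g (x', y')\<close> within \<open>K * dist x x'\<close>. Pairing with \<open>l\<close> costs
  a factor \<open>norm l\<close>, and exchanging the two points gives the other direction.\<close>

lemma lipschitz_on_u_fun: "(norm l * K)-lipschitz_on X (u_fun F g l)"
proof -
  have le: "u_fun F g l x' \<le> u_fun F g l x + norm l * K * dist x x'" if "x \<in> X" "x' \<in> X" for x x'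
  proof -
    have "u_fun F g l x' - norm l * K * dist x x' \<le> u_fun F g l x"
    proof (rule u_fun_greatest[OF that(1)])
      fix y assume "y \<in> F x"
      moreover have "{g (x, y) | y. y \<in> F x}
          \<subseteq> {a + b | a b. a \<in> {g (x', y) | y. y \<in> F x'} \<and> b \<in> cball 0 (K * dist x x')}"
        using g_lip that unfolding lipschitz_setmap_def by blast
      ultimately have "g (x, y)
          \<in> {a + b | a b. a \<in> {g (x', y) | y. y \<in> F x'} \<and> b \<in> cball 0 (K * dist x x')}"
        by blast
      then obtain y' b where y': "y' \<in> F x'" and eq: "g (x, y) = g (x', y') + b"
        and b: "norm b \<le> K * dist x x'"
        by auto
      have "- (l \<bullet> b) \<le> norm l * norm b"
        using Cauchy_Schwarz_ineq2[of l b] by linarith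
      also have "\<dots> \<le> norm l * (K * dist x x')" using b by (rule mult_left_mono) simp
      finally show "u_fun F g l x' - norm l * K * dist x x' \<le> l \<bullet> g (x, y)"
        using u_fun_le[OF that(2) y', of l] by (simp add: eq inner_add_right mult.assoc)
    qed
    then show ?thesis by simp
  qed
  show ?thesis
  proof (rule lipschitz_onI)
    fix x x' assume "x \<in> X" "x' \<in> X"
    then show "dist (u_fun F g l x) (u_fun F g l x') \<le> norm l * K * dist x x'"
      using le[of x x'] le[of x' x] by (auto simp: dist_real_def abs_le_iff dist_commute)
  qed (simp add: K_nonneg)
qed

end

section \<open>Integrals of the value function against probability measures\<close>

lemma prob_measuresD:
  assumes "m \<in> prob_measures X"
  shows "prob_space m" and "space m = X"
  using assms sets_eq_imp_space_eq[of m "restrict_space borel X"]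
  by (auto simp: prob_measures_def space_restrict_space)

lemma lipschitz_on_measurable:
  assumes m: "m \<in> prob_measures X" and h: "C-lipschitz_on X (h :: 'x::metric_space \<Rightarrow> real)"
  shows "h \<in> borel_measurable m"
proof -
  have "h \<in> borel_measurable (restrict_space borel X)"
    by (intro borel_measurable_continuous_on_restrict lipschitz_on_continuous_on[OF h])
  with m show ?thesis
    by (simp add: prob_measures_def cong: measurable_cong_sets)
qed

context dual_problem
begin

lemma integrable_u_fun:
  assumes m: "m \<in> prob_measures X"
  shows "integrable m (u_fun F g l)"
proof -
  interpret prob_space m using prob_measuresD(1)[OF m] .
  show ?thesis
    by (rule integrable_const_bound[where B = "M * norm l"])
      (use prob_measuresD(2)[OF m] abs_u_fun_le lipschitz_on_measurable[OF m lipschitz_on_u_fun]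
        in auto)
qed

lemma integral_u_fun_concave:
  assumes m: "m \<in> prob_measures X" and t: "0 \<le> t" "t \<le> 1"
  shows "(1 - t) * (LINT x|m. u_fun F g a x) + t * (LINT x|m. u_fun F g b x)
    \<le> (LINT x|m. u_fun F g ((1 - t) *\<^sub>R a + t *\<^sub>R b) x)"
proof -
  have "(1 - t) * (LINT x|m. u_fun F g a x) + t * (LINT x|m. u_fun F g b x)
      = (LINT x|m. (1 - t) * u_fun F g a x + t * u_fun F g b x)"
    by (simp add: integrable_u_fun[OF m])
  also have "\<dots> \<le> (LINT x|m. u_fun F g ((1 - t) *\<^sub>R a + t *\<^sub>R b) x)"
    by (rule integral_mono)
      (use t prob_measuresD(2)[OF m] u_fun_concave in \<open>auto simp: integrable_u_fun[OF m]\<close>)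
  finally show ?thesis .
qed

lemma integral_u_fun_diff_le:
  assumes m: "m \<in> prob_measures X"
  shows "(LINT x|m. u_fun F g a x) \<le> (LINT x|m. u_fun F g b x) + M * norm (a - b)"
proof -
  interpret prob_space m using prob_measuresD(1)[OF m] .
  have "(LINT x|m. u_fun F g a x) \<le> (LINT x|m. u_fun F g b x + M * norm (a - b))"
    by (rule integral_mono)
      (use prob_measuresD(2)[OF m] u_fun_diff_le in \<open>auto simp: integrable_u_fun[OF m]\<close>)
  then show ?thesis by (simp add: integrable_u_fun[OF m] prob_space)
qed

lemma tendsto_integral_u_fun:
  assumes m: "m \<in> prob_measures X" and s: "s \<longlonglongrightarrow> l"
  shows "(\<lambda>n. LINT x|m. u_fun F g (s n) x) \<longlonglongrightarrow> (LINT x|m. u_fun F g l x)"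
proof (rule LIM_zero_cancel, rule Lim_null_comparison)
  show "\<forall>\<^sub>F n in sequentially. norm ((LINT x|m. u_fun F g (s n) x) - (LINT x|m. u_fun F g l x))
      \<le> M * norm (s n - l)"
    using integral_u_fun_diff_le[OF m]
    by (intro always_eventually allI) (smt (verit) norm_minus_commute real_norm_def)
  show "(\<lambda>n. M * norm (s n - l)) \<longlonglongrightarrow> 0"
    using s by (intro tendsto_mult_right_zero tendsto_norm_zero LIM_zero)
qed

section \<open>Strong convexity of the dual function and attainment of its minimum\<close>

lemma strongly_convex_on_dual_fun:
  assumes m: "m \<in> prob_measures X"
    and grad: "\<And>x. GDERIV f x :> f' x" and lip: "L-lipschitz_on UNIV f'" and L: "L > 0"
  shows "strongly_convex_on (1 / (2 * L)) (dom_fstar f) (dual_fun F g f m)"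
  unfolding strongly_convex_on_def
proof (intro conjI ballI allI impI)
  note sc = strongly_convex_on_fstar[OF grad lip L, unfolded strongly_convex_on_def]
  show "convex (dom_fstar f)" using sc by blast
  fix a b and t :: real assume "a \<in> dom_fstar f" "b \<in> dom_fstar f" and t: "0 < t \<and> t < 1"
  then have "real_of_ereal (fstar f ((1 - t) *\<^sub>R a + t *\<^sub>R b))
      \<le> (1 - t) * real_of_ereal (fstar f a) + t * real_of_ereal (fstar f b)
        - 1 / (2 * L) * t * (1 - t) * (norm (a - b))\<^sup>2"
    using sc by blast
  then show "dual_fun F g f m ((1 - t) *\<^sub>R a + t *\<^sub>R b)
      \<le> (1 - t) * dual_fun F g f m a + t * dual_fun F g f m b
        - 1 / (2 * L) * t * (1 - t) * (norm (a - b))\<^sup>2"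
    using integral_u_fun_concave[OF m, of t a b] t unfolding dual_fun_def right_diff_distrib
    by linarith
qed

lemma bdd_below_dual_fun:
  assumes m: "m \<in> prob_measures X"
    and grad: "\<And>x. GDERIV f x :> f' x" and lip: "L-lipschitz_on UNIV f'" and L: "L > 0"
  shows "bdd_below (dual_fun F g f m ` dom_fstar f)"
proof (rule bdd_belowI2)
  fix l assume l: "l \<in> dom_fstar f"
  let ?U = "\<lambda>l. LINT x|m. u_fun F g l x"
  define r where "r = norm (l - f' 0)"
  have "r\<^sup>2 / (2 * L) - f 0 \<le> real_of_ereal (fstar f l)"
    unfolding r_def by (rule fstar_quadratic_lower_bound[OF grad lip L l])
  moreover have "?U l \<le> ?U (f' 0) + M * r"
    unfolding r_def by (rule integral_u_fun_diff_le[OF m])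
  \<comment> \<open>Completing the square: \<open>M * r - r\<^sup>2 / (2 * L)\<close> is largest at
    \<open>r = L * M\<close>, with value \<open>L * M\<^sup>2 / 2\<close>.\<close>
  moreover have "M * r \<le> r\<^sup>2 / (2 * L) + L * M\<^sup>2 / 2"
  proof -
    have "0 \<le> (r - L * M)\<^sup>2 / (2 * L)" using L by simp
    also have "\<dots> = r\<^sup>2 / (2 * L) + L * M\<^sup>2 / 2 - M * r"
      using L by (simp add: field_simps power2_eq_square)
    finally show ?thesis by simp
  qed
  ultimately show "- f 0 - ?U (f' 0) - L * M\<^sup>2 / 2 \<le> dual_fun F g f m l"
    by (simp add: dual_fun_def)
qed

text \<open>The conjugate is a supremum of continuous affine functions. Passing to the limit for
  each fixed \<open>\<beta>\<close> before taking the supremum shows at once that \<open>l\<close>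
  stays in the domain and that the value does not jump up.\<close>

lemma dual_fun_closed:
  assumes m: "m \<in> prob_measures X"
    and s: "\<And>n::nat. s n \<in> dom_fstar f" and l: "s \<longlonglongrightarrow> l"
    and I: "(\<lambda>n. dual_fun F g f m (s n)) \<longlonglongrightarrow> I"
  shows "l \<in> dom_fstar f \<and> dual_fun F g f m l \<le> I"
proof -
  let ?U = "\<lambda>l. LINT x|m. u_fun F g l x"
  have le: "l \<bullet> \<beta> - f \<beta> \<le> I + ?U l" for \<beta>
  proof (rule LIMSEQ_le)
    show "(\<lambda>n. s n \<bullet> \<beta> - f \<beta>) \<longlonglongrightarrow> l \<bullet> \<beta> - f \<beta>" by (intro tendsto_intros l)
    show "(\<lambda>n. dual_fun F g f m (s n) + ?U (s n)) \<longlonglongrightarrow> I + ?U l"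
      by (intro tendsto_add I tendsto_integral_u_fun[OF m] l)
    show "\<exists>N. \<forall>n\<ge>N. s n \<bullet> \<beta> - f \<beta> \<le> dual_fun F g f m (s n) + ?U (s n)"
      using fstar_upper[OF s] by (auto simp: dual_fun_def)
  qed
  show ?thesis using fstar_least[OF le] by (simp add: dual_fun_def)
qed

text \<open>\<open>lambda_star\<close> is defined by choice, so it minimizes only once some
  minimizer is known to exist.\<close>

lemma lambda_star_minimizes:
  assumes m: "m \<in> prob_measures X" and conv: "convex_on UNIV f"
    and grad: "\<And>x. GDERIV f x :> f' x" and lip: "L-lipschitz_on UNIV f'" and L: "L > 0"
  shows "lambda_star F g f m \<in> dom_fstar f"
    and "\<And>l. l \<in> dom_fstar f \<Longrightarrow> dual_fun F g f m (lambda_star F g f m) \<le> dual_fun F g f m l"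
proof -
  have "\<exists>l\<in>dom_fstar f. \<forall>x\<in>dom_fstar f. dual_fun F g f m l \<le> dual_fun F g f m x"
  proof (rule strongly_convex_on_minimizer_exists)
    show "strongly_convex_on (1 / (2 * L)) (dom_fstar f) (dual_fun F g f m)"
      by (rule strongly_convex_on_dual_fun[OF m grad lip L])
    show "dom_fstar f \<noteq> {}" using gradient_in_dom_fstar[OF conv grad] by blast
    show "bdd_below (dual_fun F g f m ` dom_fstar f)"
      by (rule bdd_below_dual_fun[OF m grad lip L])
    show "1 / (2 * L) > 0" using L by simp
  qed (rule dual_fun_closed[OF m])
  then obtain l where "is_arg_min (dual_fun F g f m) (\<lambda>l. l \<in> dom_fstar f) l"
    by (auto simp: is_arg_min_linorder)
  then have "is_arg_min (dual_fun F g f m) (\<lambda>l. l \<in> dom_fstar f) (lambda_star F g f m)"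
    unfolding lambda_star_def arg_min_on_def arg_min_def by (rule someI)
  then show "lambda_star F g f m \<in> dom_fstar f"
    and "\<And>l. l \<in> dom_fstar f \<Longrightarrow> dual_fun F g f m (lambda_star F g f m) \<le> dual_fun F g f m l"
    by (auto simp: is_arg_min_linorder)
qed

end

section \<open>Dependence on the measure\<close>

text \<open>The finite first moment dominates \<open>h - h x\<^sub>0\<close>. The second bound does
  not depend on \<open>h\<close> beyond its constant \<open>C\<close>, as needed for the supremum in
  \<open>d1\<close>.\<close>

lemma lipschitz_on_integrable:
  assumes m: "m \<in> prob_measures X" and x0: "x\<^sub>0 \<in> X" and int: "integrable m (\<lambda>x. dist x x\<^sub>0)"
    and h: "C-lipschitz_on X (h :: 'x::metric_space \<Rightarrow> real)"
  shows "integrable m h" and "\<bar>(LINT x|m. h x) - h x\<^sub>0\<bar> \<le> C * (LINT x|m. dist x x\<^sub>0)"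
proof -
  interpret prob_space m using prob_measuresD(1)[OF m] .
  have le: "\<bar>h x - h x\<^sub>0\<bar> \<le> C * dist x x\<^sub>0" if "x \<in> X" for x
    using lipschitz_onD[OF h that x0] by (simp add: dist_real_def)
  have meas: "h \<in> borel_measurable m" by (rule lipschitz_on_measurable[OF m h])
  have int': "integrable m (\<lambda>x. h x - h x\<^sub>0)"
    by (rule Bochner_Integration.integrable_bound[where f = "\<lambda>x. C * dist x x\<^sub>0"])
      (use int meas le prob_measuresD(2)[OF m] lipschitz_on_nonneg[OF h] in auto)
  from Bochner_Integration.integrable_add[OF this integrable_const[of "h x\<^sub>0"]] show int_h: "integrable m h" by simp
  have "\<bar>(LINT x|m. h x) - h x\<^sub>0\<bar> = \<bar>LINT x|m. h x - h x\<^sub>0\<bar>"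
    using int_h by (simp add: prob_space)
  also have "\<dots> \<le> (LINT x|m. \<bar>h x - h x\<^sub>0\<bar>)" by (rule integral_abs_bound)
  also have "\<dots> \<le> (LINT x|m. C * dist x x\<^sub>0)"
    by (rule integral_mono) (use int int' le prob_measuresD(2)[OF m] in auto)
  finally show "\<bar>(LINT x|m. h x) - h x\<^sub>0\<bar> \<le> C * (LINT x|m. dist x x\<^sub>0)" by simp
qed

text \<open>A real \<open>Sup\<close> bounds its set from above only if the set is bounded. Each
  integral of \<open>k\<close> is compared with the value of \<open>k\<close> at the base point of
  its own measure; \<open>dist a b\<close> pays for the change of base point.\<close>

lemma d1_upper:
  assumes m0: "m\<^sub>0 \<in> prob_measures1 X" and m1: "m\<^sub>1 \<in> prob_measures1 X"
    and h: "1-lipschitz_on X (h :: 'x::metric_space \<Rightarrow> real)"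
  shows "(LINT x|m\<^sub>0. h x) - (LINT x|m\<^sub>1. h x) \<le> d1 X m\<^sub>0 m\<^sub>1"
proof -
  from m0 obtain a where a: "m\<^sub>0 \<in> prob_measures X" "a \<in> X" "integrable m\<^sub>0 (\<lambda>x. dist x a)"
    by (auto simp: prob_measures1_def)
  from m1 obtain b where b: "m\<^sub>1 \<in> prob_measures X" "b \<in> X" "integrable m\<^sub>1 (\<lambda>x. dist x b)"
    by (auto simp: prob_measures1_def)
  have "(LINT x|m\<^sub>0. k x) - (LINT x|m\<^sub>1. k x)
      \<le> (LINT x|m\<^sub>0. dist x a) + (LINT x|m\<^sub>1. dist x b) + dist a b"
    if "1-lipschitz_on X k" for k :: "'x \<Rightarrow> real"
    using lipschitz_on_integrable(2)[OF a that] lipschitz_on_integrable(2)[OF b that]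
      lipschitz_onD[OF that a(2) b(2)] by (simp add: dist_real_def)
  then show ?thesis
    unfolding d1_def using h by (intro cSup_upper bdd_aboveI) blast+
qed

lemma d1_nonneg:
  assumes "m\<^sub>0 \<in> prob_measures1 X" "m\<^sub>1 \<in> prob_measures1 X"
  shows "0 \<le> d1 X m\<^sub>0 m\<^sub>1"
  using d1_upper[OF assms, of "\<lambda>_. 0"] by (simp add: lipschitz_on_def)

text \<open>Dividing \<open>h\<close> by \<open>C\<close> and by \<open>- C\<close> gives admissible
  test functions, and the two signs give the absolute value. For \<open>C = 0\<close> division is
  impossible, but \<open>h\<close> is constant on \<open>X\<close> and the two integrals
  agree.\<close>

lemma integral_diff_le_d1:
  assumes m0: "m\<^sub>0 \<in> prob_measures1 X" and m1: "m\<^sub>1 \<in> prob_measures1 X"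
    and h: "C-lipschitz_on X (h :: 'x::metric_space \<Rightarrow> real)"
  shows "\<bar>(LINT x|m\<^sub>0. h x) - (LINT x|m\<^sub>1. h x)\<bar> \<le> C * d1 X m\<^sub>0 m\<^sub>1"
proof (cases "C = 0")
  case True
  from m0 obtain a where a: "m\<^sub>0 \<in> prob_measures X" "a \<in> X" by (auto simp: prob_measures1_def)
  from m1 have b: "m\<^sub>1 \<in> prob_measures X" by (auto simp: prob_measures1_def)
  have const: "h x = h a" if "x \<in> X" for x
    using lipschitz_onD[OF h that a(2)] True by simp
  have "(LINT x|m. h x) = h a" if m: "m \<in> prob_measures X" for m
  proof -
    interpret prob_space m using prob_measuresD(1)[OF m] .
    have "(LINT x|m. h x) = (LINT x|m. h a)"
      using const prob_measuresD(2)[OF m] by (intro Bochner_Integration.integral_cong) auto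
    then show ?thesis by (simp add: prob_space)
  qed
  with a b True show ?thesis by simp
next
  case False
  then have C: "C > 0" using lipschitz_on_nonneg[OF h] by simp
  have lip: "1-lipschitz_on X (\<lambda>x. c * h x)" if "\<bar>c\<bar> = 1 / C" for c
  proof (rule lipschitz_onI)
    fix x y assume "x \<in> X" "y \<in> X"
    from lipschitz_onD[OF h this] have "\<bar>c\<bar> * \<bar>h x - h y\<bar> \<le> \<bar>c\<bar> * (C * dist x y)"
      by (intro mult_left_mono) (auto simp: dist_real_def)
    then show "dist (c * h x) (c * h y) \<le> 1 * dist x y"
      using that C by (simp add: dist_real_def abs_mult flip: right_diff_distrib)
  qed simp
  from d1_upper[OF m0 m1 lip[of "1 / C"]] d1_upper[OF m0 m1 lip[of "- (1 / C)"]] C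
  show ?thesis by (simp add: abs_le_iff field_simps)
qed

section \<open>Comparison of two dual functions and of their minimizers\<close>

context dual_problem
begin

text \<open>The conjugate terms cancel, leaving two integrals of the same Lipschitz function
  \<open>u_fun F g l\<close>.\<close>

lemma dual_fun_diff_le_d1:
  assumes m: "m\<^sub>0 \<in> prob_measures1 X" "m\<^sub>1 \<in> prob_measures1 X" and l: "norm l \<le> C"
  shows "\<bar>dual_fun F g f m\<^sub>0 l - dual_fun F g f m\<^sub>1 l\<bar> \<le> C * K * d1 X m\<^sub>0 m\<^sub>1"
proof -
  have "\<bar>dual_fun F g f m\<^sub>0 l - dual_fun F g f m\<^sub>1 l\<bar> \<le> norm l * K * d1 X m\<^sub>0 m\<^sub>1"
    using integral_diff_le_d1[OF m lipschitz_on_u_fun, of l] by (simp add: dual_fun_def abs_minus_commute)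
  also have "\<dots> \<le> C * K * d1 X m\<^sub>0 m\<^sub>1"
    using l K_nonneg d1_nonneg[OF m] by (intro mult_right_mono)
  finally show ?thesis .
qed

lemma lambda_star_stability:
  assumes m0: "m\<^sub>0 \<in> prob_measures1 X" and m1: "m\<^sub>1 \<in> prob_measures1 X"
    and conv: "convex_on UNIV f" and grad: "\<And>x. GDERIV f x :> f' x"
    and lip: "L-lipschitz_on UNIV f'" and L: "L > 0"
    and C: "norm (lambda_star F g f m\<^sub>0) \<le> C" "norm (lambda_star F g f m\<^sub>1) \<le> C"
  shows "\<bar>dual_fun F g f m\<^sub>0 (lambda_star F g f m\<^sub>0) - dual_fun F g f m\<^sub>1 (lambda_star F g f m\<^sub>1)\<bar>
      \<le> C * K * d1 X m\<^sub>0 m\<^sub>1"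
    and "(norm (lambda_star F g f m\<^sub>0 - lambda_star F g f m\<^sub>1))\<^sup>2 \<le> 2 * C * K * L * d1 X m\<^sub>0 m\<^sub>1"
proof -
  have p0: "m\<^sub>0 \<in> prob_measures X" and p1: "m\<^sub>1 \<in> prob_measures X"
    using m0 m1 by (auto simp: prob_measures1_def)
  define l0 where "l0 = lambda_star F g f m\<^sub>0"
  define l1 where "l1 = lambda_star F g f m\<^sub>1"
  define \<delta> where "\<delta> = C * K * d1 X m\<^sub>0 m\<^sub>1"
  note min0 = lambda_star_minimizes[OF p0 conv grad lip L, folded l0_def]
  note min1 = lambda_star_minimizes[OF p1 conv grad lip L, folded l1_def]
  have near: "\<bar>dual_fun F g f m\<^sub>0 l0 - dual_fun F g f m\<^sub>1 l0\<bar> \<le> \<delta>"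
    "\<bar>dual_fun F g f m\<^sub>0 l1 - dual_fun F g f m\<^sub>1 l1\<bar> \<le> \<delta>"
    using C dual_fun_diff_le_d1[OF m0 m1] by (simp_all add: l0_def l1_def \<delta>_def)
  show "\<bar>dual_fun F g f m\<^sub>0 (lambda_star F g f m\<^sub>0) - dual_fun F g f m\<^sub>1 (lambda_star F g f m\<^sub>1)\<bar>
      \<le> C * K * d1 X m\<^sub>0 m\<^sub>1"
    \<comment> \<open>Each optimal value is at most the value at the other minimizer, which is
      within \<open>\<delta>\<close> of the other optimal value.\<close>
    using near min0(2)[OF min1(1)] min1(2)[OF min0(1)]
    unfolding l0_def[symmetric] l1_def[symmetric] \<delta>_def[symmetric] by linarith
  have "dual_fun F g f m\<^sub>0 l0 + 1 / (2 * L) * (norm (l0 - l1))\<^sup>2 \<le> dual_fun F g f m\<^sub>0 l1"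
    by (rule strongly_convex_on_growth[OF strongly_convex_on_dual_fun[OF p0 grad lip L]
          min0(1) min1(1) min0(2)])
  moreover have "dual_fun F g f m\<^sub>1 l1 + 1 / (2 * L) * (norm (l1 - l0))\<^sup>2 \<le> dual_fun F g f m\<^sub>1 l0"
    by (rule strongly_convex_on_growth[OF strongly_convex_on_dual_fun[OF p1 grad lip L]
          min1(1) min0(1) min1(2)])
  \<comment> \<open>In the sum of the two growth inequalities, only the differences of the dual
    functions at \<open>l0\<close> and at \<open>l1\<close> remain on the right, each at most
    \<open>\<delta>\<close>.\<close>
  ultimately have "2 * (1 / (2 * L) * (norm (l0 - l1))\<^sup>2) \<le> 2 * \<delta>"
    using near by (simp add: norm_minus_commute abs_le_iff)
  then show "(norm (lambda_star F g f m\<^sub>0 - lambda_star F g f m\<^sub>1))\<^sup>2 \<le> 2 * C * K * L * d1 X m\<^sub>0 m\<^sub>1"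
    unfolding l0_def[symmetric] l1_def[symmetric]
    using L by (simp add: \<delta>_def field_simps)
qed

end

theorem lemma5p4:
  fixes X :: "'x::{banach, second_countable_topology} set"
    and F :: "'x \<Rightarrow> 'y::polish_space set"
    and g :: "'x \<times> 'y \<Rightarrow> 'h::{real_inner, banach, second_countable_topology}"
    and f :: "'h \<Rightarrow> real"
    and grad_f :: "'h \<Rightarrow> 'h"
    and L L\<^sub>g C :: real
    and m\<^sub>0 m\<^sub>1 :: "'x measure"
  assumes X_closed: "closed X"
    and F_nonempty: "\<And>x. x \<in> X \<Longrightarrow> F x \<noteq> {}"
    and F_closed_graph: "closedin (top_of_set (X \<times> UNIV)) (graph_on X F)"
    and g_measurable: "g \<in> borel_measurable (restrict_space borel (graph_on X F))"
    and f_measurable: "f \<in> borel_measurable borel"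
    and g_bounded: "bounded (g ` graph_on X F)"
    and f_convex: "convex_on UNIV f"
    and f_gradient: "\<And>\<beta>. GDERIV f \<beta> :> grad_f \<beta>"
    and grad_f_lipschitz: "L-lipschitz_on UNIV grad_f"
    and g_lsc: "\<And>l. l \<in> dom_fstar f \<Longrightarrow> lsc_on (graph_on X F) (\<lambda>z. l \<bullet> g z)"
    and G_lsc: "\<And>l. l \<in> dom_fstar f \<Longrightarrow> lsc_setmap X (G_map F g l)"
    and BR_nonempty: "\<And>l x. l \<in> dom_fstar f \<Longrightarrow> x \<in> X \<Longrightarrow> BR F g l x \<noteq> {}"
    and g_continuous: "continuous_on (graph_on X F) g"
    and F_compact: "\<And>x. x \<in> X \<Longrightarrow> compact (F x)"
    and F_usc: "usc_setmap X F"
    and L\<^sub>g_nonneg: "L\<^sub>g \<ge> 0"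
    and Z_lipschitz: "lipschitz_setmap L\<^sub>g X (\<lambda>x. {g (x, y) | y. y \<in> F x})"
    and C_bound: "\<And>m. m \<in> prob_measures X \<Longrightarrow> norm (lambda_star F g f m) \<le> C"
    and m\<^sub>0: "m\<^sub>0 \<in> prob_measures1 X"
    and m\<^sub>1: "m\<^sub>1 \<in> prob_measures1 X"
  shows "\<bar>dual_fun F g f m\<^sub>0 (lambda_star F g f m\<^sub>0) - dual_fun F g f m\<^sub>1 (lambda_star F g f m\<^sub>1)\<bar>
           \<le> C * L\<^sub>g * d1 X m\<^sub>0 m\<^sub>1
       \<and> (norm (lambda_star F g f m\<^sub>0 - lambda_star F g f m\<^sub>1))\<^sup>2 \<le> 2 * C * L\<^sub>g * L * d1 X m\<^sub>0 m\<^sub>1"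
proof -
  obtain M where "\<And>z. z \<in> graph_on X F \<Longrightarrow> norm (g z) \<le> M"
    using g_bounded by (auto simp: bounded_iff)
  then interpret dual_problem X F g L\<^sub>g M
    using F_nonempty L\<^sub>g_nonneg Z_lipschitz by unfold_locales (auto simp: graph_on_def)
  have C: "norm (lambda_star F g f m\<^sub>0) \<le> C" "norm (lambda_star F g f m\<^sub>1) \<le> C"
    using C_bound m\<^sub>0 m\<^sub>1 by (auto simp: prob_measures1_def)
  \<comment> \<open>The case \<open>L = 0\<close> is reached as a limit of Lipschitz constants \<open>L' > L\<close>.\<close>
  have lip: "L'-lipschitz_on UNIV grad_f" and pos: "L' > 0" if "L' > L" for L'
    using that lipschitz_on_mono[OF grad_f_lipschitz] lipschitz_on_nonneg[OF grad_f_lipschitz]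
    by auto
  note stab = lambda_star_stability[OF m\<^sub>0 m\<^sub>1 f_convex f_gradient lip pos C]
  have "(norm (lambda_star F g f m\<^sub>0 - lambda_star F g f m\<^sub>1))\<^sup>2 \<le> 2 * C * L\<^sub>g * L * d1 X m\<^sub>0 m\<^sub>1"
  proof (rule tendsto_lowerbound)
    show "((\<lambda>L'. 2 * C * L\<^sub>g * L' * d1 X m\<^sub>0 m\<^sub>1) \<longlongrightarrow> 2 * C * L\<^sub>g * L * d1 X m\<^sub>0 m\<^sub>1) (at_right L)"
      by (intro tendsto_intros)
    show "\<forall>\<^sub>F L' in at_right L. (norm (lambda_star F g f m\<^sub>0 - lambda_star F g f m\<^sub>1))\<^sup>2
        \<le> 2 * C * L\<^sub>g * L' * d1 X m\<^sub>0 m\<^sub>1"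
      unfolding eventually_at_right_field by (rule exI[of _ "L + 1"]) (use stab(2) in auto)
  qed simp
  \<comment> \<open>The first estimate does not involve the Lipschitz constant of the gradient, so
    any admissible one, such as \<open>L + 1\<close>, gives it.\<close>
  with stab(1)[of "L + 1"] show ?thesis by simp
qed

end
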